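(* Let $n$ be an even positive integer and let $X_i=(X_{1i},\dots,X_{pi})'$, $i=1,\dots,n$, be independent and identically distributed random vectors of dimension $p$ such that $X_1$ admits a density $f_X$ with respect to the Lebesgue measure on $[0,1]^p$ and there exist positive constants $\underline{C},\overline{C}$ (independent of $p$) with $\underline{C}\le f_X(x)\le\overline{C}$ for every $x\in[0,1]^p$. Let $(D_1,\dots,D_n)\in\{0,1\}^n$ be generated by the cube method with assignment probabilities $\pi_i=1/2$ for all $i$, balancing variables $Z_i=(1,X_i')'\in\mathbb{R}^{p+1}$, and a landing phase using linear programming with symmetric positive-definite matrix $M$ of size $(p+1)\times(p+1)$. Let $$B_{n,p}(X)=\frac2n\sum_{i=1}^n\left(X_iD_i-X_i(1-D_i)\right).$$ Then $$\mathbb{E}\left[\|B_{n,p}(X)\|^2\right]\le 4\,\frac{(p+1)^2}{n^2}\,\frac{\lambda_{max}(M)}{\lambda_{min}(M)},$$ where $\|\cdot\|$ is the Euclidean norm and $\lambda_{max}(M)$, $\lambda_{min}(M)$ are the largest and the smallest eigenvalues of $M$.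
   Context: Cube method. Given $\boldsymbol{\pi}=(\pi_1,\dots,\pi_n)\in(0,1)^n$ and balancing vectors $Z_1,\dots,Z_n\in\mathbb{R}^q$ (here $q=p+1$), let $C=[0,1]^n$, let $A$ be the $q\times n$ matrix with columns $Z_i/\pi_i$, and let $K=C\cap(\boldsymbol{\pi}+\ker A)$, the set of $s\in C$ with $\sum_i Z_is_i/\pi_i=\sum_i Z_i$. Flight phase: starting from $\boldsymbol{\pi}(0)=\boldsymbol{\pi}$, one builds a random sequence $\boldsymbol{\pi}(t)\in K$; at each step a random direction in $\ker A$ is chosen (coordinates already equal to $0$ or $1$ are kept fixed) and one moves along it up to a facet of the current face of $K$, in such a way that $\mathbb{E}[\boldsymbol{\pi}(t+1)\mid\boldsymbol{\pi}(t)]=\boldsymbol{\pi}(t)$; each step fixes at least one more coordinate to $0$ or $1$. It ends at a vertex $\boldsymbol{\pi}^\ast$ of $K$, at which at most $q$ coordinates are not in $\{0,1\}$. Let $S$ be the set of units with $\pi_i^\ast\in\{0,1\}$; they get $D_i=\pi_i^\ast$. Landing phase by linear programming with matrix $M$: conditionally on $W=(S,(D_i)_{i\in S},(\pi_i^\ast)_{i\notin S},(Z_i)_{i=1,\dots,n})$, the vector $(D_i)_{i\notin S}$ is drawn from a probability distribution on $\{0,1\}^{S^c}$ that minimizes $$\mathbb{E}\left(\Big(\sum_{i\notin S}Z_i(D_i-\pi_i^\ast)\Big)'M\Big(\sum_{i\notin S}Z_i(D_i-\pi_i^\ast)\Big)\,\Big|\,W\right)$$ among all distributions satisfying $\mathbb{E}[D_i\mid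 W]=\pi_i^\ast$ for all $i\notin S$. *)

theory Defs
  imports "HOL-Probability.Probability"
begin

text \<open>
  Units are the elements of a finite type \<open>'n\<close>, so that \<open>n = CARD('n)\<close>. The balancing vectors
  \<open>Z\<^sub>i\<close> are the rows \<open>z $ i\<close> of an array \<open>z :: real^'q^'n\<close>.
\<close>

definition fixed_units :: "real^'n \<Rightarrow> 'n set" where
  "fixed_units s = {i. s $ i \<in> {0, 1}}"

definition balancing_matrix :: "real^'n \<Rightarrow> real^'q^'n \<Rightarrow> real^'n^'q" where
  "balancing_matrix \<pi> z = (\<chi> k i. z $ i $ k / \<pi> $ i)"

definition balancing_kernel :: "real^'n \<Rightarrow> real^'q^'n \<Rightarrow> (real^'n) set" where
  "balancing_kernel \<pi> z = {u. balancing_matrix \<pi> z *v u = 0}"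

definition balancing_polytope :: "real^'n \<Rightarrow> real^'q^'n \<Rightarrow> (real^'n) set" where
  "balancing_polytope \<pi> z = cbox 0 1 \<inter> (+) \<pi> ` balancing_kernel \<pi> z"

text \<open>The smallest face of the polytope that contains \<open>s\<close>.\<close>

definition current_face :: "real^'n \<Rightarrow> real^'q^'n \<Rightarrow> real^'n \<Rightarrow> (real^'n) set" where
  "current_face \<pi> z s = {x \<in> balancing_polytope \<pi> z. \<forall>i\<in>fixed_units s. x $ i = s $ i}"

text \<open>
  One move of the flight phase. The walk stays put once it is at a vertex; otherwise \<open>s\<close> is in the
  relative interior of its current face, hence in none of its facets, and \<open>c *\<^sub>R u \<noteq> 0\<close>.
\<close>

definition flight_step :: "real^'n \<Rightarrow> real^'q^'n \<Rightarrow> real^'n \<Rightarrow> real^'n \<Rightarrow> bool" where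
  "flight_step \<pi> z s s' \<longleftrightarrow>
     (if s extreme_point_of balancing_polytope \<pi> z then s' = s
      else \<exists>u c G. u \<in> balancing_kernel \<pi> z \<and> (\<forall>i\<in>fixed_units s. u $ i = 0) \<and>
             s' = s + c *\<^sub>R u \<and> G facet_of current_face \<pi> z s \<and> s' \<in> G)"

text \<open>
  The balancing vectors \<open>Z\<close> may be random. The algorithm is run given \<open>Z\<close>, so conditional
  expectations are taken given \<open>Z\<close> as well; they are stated coordinatewise.
  The walk \<open>w\<close> ends at \<open>\<pi>'\<close>, its position at the first time it is at a vertex.
\<close>

definition flight_phase ::
  "'w measure \<Rightarrow> real^'n \<Rightarrow> ('w \<Rightarrow> real^'q^'n) \<Rightarrow> (nat \<Rightarrow> 'w \<Rightarrow> real^'n) \<Rightarrow> ('w \<Rightarrow> real^'n) \<Rightarrow> bool"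
where
  "flight_phase P \<pi> Z w \<pi>' \<longleftrightarrow>
     (\<forall>t. w t \<in> borel_measurable P) \<and> \<pi>' \<in> borel_measurable P \<and>
     (AE \<omega> in P. w 0 \<omega> = \<pi>) \<and>
     (\<forall>t. AE \<omega> in P. flight_step \<pi> (Z \<omega>) (w t \<omega>) (w (Suc t) \<omega>)) \<and>
     (\<forall>t i. AE \<omega> in P.
        real_cond_exp P (vimage_algebra (space P) (\<lambda>\<omega>. (w t \<omega>, Z \<omega>)) borel)
          (\<lambda>\<omega>. w (Suc t) \<omega> $ i) \<omega> = w t \<omega> $ i) \<and>
     (AE \<omega> in P. \<pi>' \<omega> = w (LEAST t. w t \<omega> extreme_point_of balancing_polytope \<pi> (Z \<omega>)) \<omega>)"

text \<open>
  A distribution on \<open>{0,1}\<close>-vectors indexed by the units that are not fixed at the end point \<open>s\<close> of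
  the flight phase is encoded as a distribution on \<open>{0,1}\<close>-vectors indexed by all units that gives
  the fixed units their value in \<open>s\<close>.
\<close>

definition landing_designs :: "real^'n \<Rightarrow> (real^'n) pmf set" where
  "landing_designs s =
     {\<mu>. (\<forall>d\<in>set_pmf \<mu>. (\<forall>i. d $ i \<in> {0, 1}) \<and> (\<forall>i\<in>fixed_units s. d $ i = s $ i)) \<and>
         (\<forall>i\<in>- fixed_units s. measure_pmf.expectation \<mu> (\<lambda>d. d $ i) = s $ i)}"

definition landing_cost :: "real^'q^'q \<Rightarrow> real^'q^'n \<Rightarrow> real^'n \<Rightarrow> (real^'n) pmf \<Rightarrow> real" where
  "landing_cost M z s \<mu> =
     measure_pmf.expectation \<mu>
       (\<lambda>d. let v = (\<Sum>i\<in>- fixed_units s. (d $ i - s $ i) *\<^sub>R z $ i) in v \<bullet> (M *v v))"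

text \<open>
  \<open>\<mu>\<close> is the conditional distribution of \<open>D\<close> given \<open>(\<pi>', Z)\<close>. This pair generates the same
  \<open>\<sigma>\<close>-algebra as the fixed units, their values, the values of \<open>\<pi>'\<close> at the other units, and \<open>Z\<close>.
\<close>

definition landing_phase ::
  "'w measure \<Rightarrow> real^'q^'q \<Rightarrow> ('w \<Rightarrow> real^'q^'n) \<Rightarrow> ('w \<Rightarrow> real^'n) \<Rightarrow> ('w \<Rightarrow> real^'n) \<Rightarrow> bool"
where
  "landing_phase P M Z \<pi>' D \<longleftrightarrow>
     (\<exists>\<mu>. (\<forall>d. AE \<omega> in P.
             real_cond_exp P (vimage_algebra (space P) (\<lambda>\<omega>. (\<pi>' \<omega>, Z \<omega>)) borel)
               (indicat_real (D -` {d})) \<omega> = pmf (\<mu> \<omega>) d) \<and>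
          (AE \<omega> in P. is_arg_min (landing_cost M (Z \<omega>) (\<pi>' \<omega>))
                        (\<lambda>\<nu>. \<nu> \<in> landing_designs (\<pi>' \<omega>)) (\<mu> \<omega>)))"

definition cube_method ::
  "'w measure \<Rightarrow> real^'q^'q \<Rightarrow> real^'n \<Rightarrow> ('w \<Rightarrow> real^'q^'n) \<Rightarrow> ('w \<Rightarrow> real^'n) \<Rightarrow> bool"
where
  "cube_method P M \<pi> Z D \<longleftrightarrow>
     Z \<in> borel_measurable P \<and> D \<in> borel_measurable P \<and>
     (\<forall>\<omega>\<in>space P. \<forall>i. D \<omega> $ i \<in> {0, 1}) \<and>
     (\<exists>w \<pi>'. flight_phase P \<pi> Z w \<pi>' \<and> landing_phase P M Z \<pi>' D)"

text \<open>The vector \<open>(1, x')'\<close>; the index type \<open>'p option\<close> has \<open>CARD('p) + 1\<close> elements.\<close>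

definition with_intercept :: "real^'p \<Rightarrow> real^'p option" where
  "with_intercept x = (\<chi> k. case k of None \<Rightarrow> 1 | Some j \<Rightarrow> x $ j)"

definition eigenvalues :: "real^'q^'q \<Rightarrow> real set" where
  "eigenvalues M = {l. \<exists>v. v \<noteq> 0 \<and> M *v v = l *\<^sub>R v}"

definition sym_pos_def :: "real^'q^'q \<Rightarrow> bool" where
  "sym_pos_def M \<longleftrightarrow> transpose M = M \<and> (\<forall>v. v \<noteq> 0 \<longrightarrow> 0 < v \<bullet> (M *v v))"

definition imbalance :: "('n \<Rightarrow> real^'p) \<Rightarrow> real^'n \<Rightarrow> real^'p" where
  "imbalance x d =
     (2 / real CARD('n)) *\<^sub>R (\<Sum>i\<in>UNIV. d $ i *\<^sub>R x i - (1 - d $ i) *\<^sub>R x i)"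

end

theory Submission
  imports Defs
begin

text \<open>
  The walk of the flight phase stays in the balancing polytope, so the imbalance is at most \<open>4 / n\<close>
  times the norm of \<open>V = \<Sum>\<^sub>i (D\<^sub>i - \<pi>'\<^sub>i) Z\<^sub>i\<close>. At the vertex \<open>\<pi>'\<close> at most \<open>q = p + 1\<close> units are
  not fixed, since otherwise a nonzero kernel vector supported on these units would give a segment in
  the polytope around \<open>\<pi>'\<close>. The landing phase is no more costly than drawing the remaining units
  independently, which costs \<open>\<Sum>\<^sub>i \<pi>'\<^sub>i (1 - \<pi>'\<^sub>i) Z\<^sub>i \<bullet> M Z\<^sub>i \<le> q \<cdot> 1/4 \<cdot> \<lambda>\<^sub>m\<^sub>a\<^sub>x (p + 1)\<close>, and the cost is at
  least \<open>\<lambda>\<^sub>m\<^sub>i\<^sub>n\<close> times the conditional expectation of the squared norm of \<open>V\<close>.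
\<close>

subsection \<open>Eigenvalues of symmetric matrices\<close>

lemma symmetric_matrix_inner:
  fixes M :: "real^'q::finite^'q"
  assumes "transpose M = M"
  shows "x \<bullet> (M *v y) = (M *v x) \<bullet> y"
  by (metis assms dot_lmul_matrix transpose_matrix_vector)

text \<open>Eigenvectors of a symmetric matrix for different eigenvalues are orthogonal, hence
  independent, so choosing one per eigenvalue embeds the spectrum into an independent set.
  Finiteness is what gives \<open>Max\<close> and \<open>Min\<close> of the spectrum their usual
  meaning.\<close>

lemma finite_eigenvalues_symmetric:
  fixes M :: "real^'q::finite^'q"
  assumes "transpose M = M"
  shows "finite (eigenvalues M)"
proof -
  have "\<forall>l\<in>eigenvalues M. \<exists>v. v \<noteq> 0 \<and> M *v v = l *\<^sub>R v"
    by (simp add: eigenvalues_def)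
  then obtain v where v: "\<And>l. l \<in> eigenvalues M \<Longrightarrow> v l \<noteq> 0 \<and> M *v v l = l *\<^sub>R v l"
    by (auto dest!: bchoice)
  have orth: "v k \<bullet> v l = 0" if "k \<in> eigenvalues M" "l \<in> eigenvalues M" "k \<noteq> l" for k l
    using symmetric_matrix_inner[OF assms, of "v k" "v l"] v that by auto
  have inj: "inj_on v (eigenvalues M)"
    by (rule inj_onI) (metis inner_eq_zero_iff orth v)
  have "independent (v ` eigenvalues M)"
    by (rule pairwise_orthogonal_independent) (use orth v in \<open>auto simp: pairwise_def orthogonal_def\<close>)
  then show ?thesis
    using finite_image_iff[OF inj] independent_imp_finite by blast
qed

text \<open>The quadratic form attains its maximum over the compact unit sphere, and a maximizer is
  an eigenvector. The bound extends to all vectors by homogeneity. In particular the spectrum is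
  nonempty.\<close>

lemma symmetric_matrix_max_eigenvalue:
  fixes M :: "real^'q::finite^'q"
  assumes "transpose M = M"
  obtains l where "l \<in> eigenvalues M" "\<And>x. x \<bullet> (M *v x) \<le> l * (x \<bullet> x)"
proof -
  let ?S = "sphere (0 :: real^'q) 1"
  have "\<exists>v\<in>?S. \<forall>x\<in>?S. x \<bullet> (M *v x) \<le> v \<bullet> (M *v v)"
    by (intro continuous_attains_sup continuous_intros linear_continuous_on
        matrix_vector_mul_bounded_linear) auto
  then obtain v where v: "norm v = 1" "\<And>x. norm x = 1 \<Longrightarrow> x \<bullet> (M *v x) \<le> v \<bullet> (M *v v)"
    by auto
  define l where "l = v \<bullet> (M *v v)"
  have le: "x \<bullet> (M *v x) \<le> l * (x \<bullet> x)" for x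
  proof (cases "x = 0")
    case False
    then show ?thesis
      using v(2)[of "x /\<^sub>R norm x"]
      by (simp add: l_def[symmetric] matrix_vector_mult_scaleR dot_square_norm power2_eq_square field_simps)
  qed simp
  \<comment> \<open>The quadratic form \<open>l * (x \<bullet> x) - x \<bullet> (M *v x)\<close> is nonnegative and vanishes at \<open>v\<close>, so its derivative at \<open>v\<close> vanishes.\<close>
  have "y \<bullet> (l *\<^sub>R v - M *v v) = 0" for y
  proof (rule ccontr)
    assume ne: "y \<bullet> (l *\<^sub>R v - M *v v) \<noteq> 0" (is "?b \<noteq> 0")
    define Q where "Q = l * (y \<bullet> y) - y \<bullet> (M *v y)"
    have nn: "0 \<le> 2 * t * ?b + t\<^sup>2 * Q" for t
    proof -
      have "l * ((v + t *\<^sub>R y) \<bullet> (v + t *\<^sub>R y)) - (v + t *\<^sub>R y) \<bullet> (M *v (v + t *\<^sub>R y))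
        = 2 * t * ?b + t\<^sup>2 * Q"
        using v(1) symmetric_matrix_inner[OF assms, of y v]
        by (simp add: Q_def l_def matrix_vector_right_distrib matrix_vector_mult_scaleR inner_add_left
            inner_add_right inner_diff_right inner_commute norm_eq_1 power2_eq_square algebra_simps)
      then show ?thesis using le[of "v + t *\<^sub>R y"] by linarith
    qed
    have "Q \<ge> 0" using le[of y] by (simp add: Q_def)
    \<comment> \<open>For \<open>Q > 0\<close> the quadratic in \<open>t\<close> is minimal at
      \<open>- ?b / Q\<close>; the added 1 keeps the denominator positive when \<open>Q = 0\<close>,
      and the value is still negative.\<close>
    define t where "t = - ?b / (Q + 1)"
    have t: "?b = - t * (Q + 1)" "t \<noteq> 0"
      using ne \<open>Q \<ge> 0\<close> by (auto simp: t_def)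
    have "2 * t * ?b + t\<^sup>2 * Q = - (t\<^sup>2 * (Q + 2))"
      unfolding t(1) by (simp add: power2_eq_square algebra_simps)
    also have "\<dots> < 0" using t(2) \<open>Q \<ge> 0\<close> by simp
    finally show False using nn[of t] by simp
  qed
  then have "M *v v = l *\<^sub>R v"
    by (metis inner_eq_zero_iff right_minus_eq)
  then have "l \<in> eigenvalues M" using v(1) unfolding eigenvalues_def
    by (intro CollectI exI[of _ v]) auto
  with le show thesis by (rule that[rotated])
qed

lemma rayleigh_le_Max_eigenvalues:
  fixes M :: "real^'q::finite^'q"
  assumes "transpose M = M"
  shows "x \<bullet> (M *v x) \<le> Max (eigenvalues M) * (x \<bullet> x)"
proof -
  obtain l where l: "l \<in> eigenvalues M" "x \<bullet> (M *v x) \<le> l * (x \<bullet> x)"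
    using symmetric_matrix_max_eigenvalue[OF assms] by metis
  have "l * (x \<bullet> x) \<le> Max (eigenvalues M) * (x \<bullet> x)"
    using l(1) finite_eigenvalues_symmetric[OF assms] by (intro mult_right_mono) auto
  with l(2) show ?thesis by simp
qed

text \<open>The upper bound is applied to \<open>- M\<close>, whose eigenvalues are the negatives of
  those of \<open>M\<close>.\<close>

lemma rayleigh_ge_Min_eigenvalues:
  fixes M :: "real^'q::finite^'q"
  assumes "transpose M = M"
  shows "Min (eigenvalues M) * (x \<bullet> x) \<le> x \<bullet> (M *v x)"
proof -
  have neg: "(- M) *v x = - (M *v x)" for x
    by (simp add: vec_eq_iff matrix_vector_mult_def sum_negf)
  have "transpose (- M) = - M"
    using assms by (simp add: vec_eq_iff transpose_def)
  then obtain l where l: "l \<in> eigenvalues (- M)" "x \<bullet> ((- M) *v x) \<le> l * (x \<bullet> x)"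
    using symmetric_matrix_max_eigenvalue by metis
  from l(1) have "- l \<in> eigenvalues M"
    by (auto simp: eigenvalues_def neg) (metis minus_minus scaleR_minus_left)
  then have "Min (eigenvalues M) * (x \<bullet> x) \<le> - l * (x \<bullet> x)"
    using finite_eigenvalues_symmetric[OF assms] by (intro mult_right_mono) auto
  with l(2) show ?thesis by (simp add: neg)
qed

lemma Min_eigenvalues_pos:
  fixes M :: "real^'q::finite^'q"
  assumes "sym_pos_def M"
  shows "0 < Min (eigenvalues M)"
proof -
  have sym: "transpose M = M" using assms by (simp add: sym_pos_def_def)
  obtain l where "l \<in> eigenvalues M" using symmetric_matrix_max_eigenvalue[OF sym] by metis
  then have "Min (eigenvalues M) \<in> eigenvalues M"
    using finite_eigenvalues_symmetric[OF sym] by (intro Min_in) auto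
  then obtain v where "v \<noteq> 0" "M *v v = Min (eigenvalues M) *\<^sub>R v" by (auto simp: eigenvalues_def)
  then have "0 < Min (eigenvalues M) * (v \<bullet> v)"
    using assms by (metis sym_pos_def_def inner_scaleR_right)
  then show ?thesis using inner_ge_zero[of v] by (simp add: zero_less_mult_iff)
qed

subsection \<open>Independent rounding\<close>

text \<open>For \<open>s\<close> in the unit cube this is the Poisson sampling design with inclusion
  probabilities \<open>s\<close>. Coordinates of \<open>s\<close> equal to 0 or 1 become
  deterministic, so fixed units need no separate treatment.\<close>

definition bernoulli_design :: "real^'n::finite \<Rightarrow> (real^'n) pmf" where
  "bernoulli_design s =
     map_pmf (\<lambda>b. \<chi> i. of_bool (b i)) (Pi_pmf UNIV False (\<lambda>i. bernoulli_pmf (s $ i)))"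

lemma finite_binary_vectors: "finite {d :: real^'n::finite. \<forall>i. d $ i \<in> {0, 1}}"
proof -
  have "{d :: real^'n. \<forall>i. d $ i \<in> {0, 1}} \<subseteq> range (\<lambda>b. \<chi> i. of_bool (b i))"
  proof
    fix d :: "real^'n" assume "d \<in> {d. \<forall>i. d $ i \<in> {0, 1}}"
    then have "d = (\<chi> i. of_bool (d $ i = 1))"
      by (force simp: vec_eq_iff)
    then show "d \<in> range (\<lambda>b. \<chi> i. of_bool (b i))" by (rule range_eqI[where x = "\<lambda>i. d $ i = 1"])
  qed
  then show ?thesis by (rule finite_subset) auto
qed

text \<open>A general \<open>g\<close> covers both the mean and the variance of a
  coordinate.\<close>

lemma expectation_bernoulli_design:
  fixes g :: "real \<Rightarrow> real"
  assumes "0 \<le> s $ i" "s $ i \<le> 1"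
  shows "measure_pmf.expectation (bernoulli_design s) (\<lambda>d. g (d $ i)) = g 1 * s $ i + g 0 * (1 - s $ i)"
proof -
  have "map_pmf (\<lambda>d. d $ i) (bernoulli_design s)
    = map_pmf of_bool (map_pmf (\<lambda>b. b i) (Pi_pmf UNIV False (\<lambda>i. bernoulli_pmf (s $ i))))"
    by (simp add: bernoulli_design_def map_pmf_comp)
  also have "\<dots> = map_pmf of_bool (bernoulli_pmf (s $ i))"
    by (simp add: Pi_pmf_component)
  finally have "measure_pmf.expectation (map_pmf (\<lambda>d. d $ i) (bernoulli_design s)) g
    = measure_pmf.expectation (map_pmf of_bool (bernoulli_pmf (s $ i))) g"
    by simp
  then show ?thesis using assms by simp
qed

lemma expectation_bernoulli_design_mult:
  fixes s :: "real^'n::finite"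
  assumes "i \<noteq> j" "\<And>k. 0 \<le> s $ k \<and> s $ k \<le> 1"
  shows "measure_pmf.expectation (bernoulli_design s) (\<lambda>d. d $ i * d $ j) = s $ i * s $ j"
proof -
  \<comment> \<open>Padding with the constant factor 1 turns the product of two coordinates into a
    product over all units, to which independence applies.\<close>
  define f :: "'n \<Rightarrow> bool \<Rightarrow> real" where "f k b = (if k \<in> {i, j} then of_bool b else 1)" for k b
  have "(\<Prod>k\<in>UNIV. f k (b k)) = of_bool (b i) * of_bool (b j)" for b
  proof -
    have "(\<Prod>k\<in>UNIV. f k (b k)) = (\<Prod>k\<in>{i, j}. of_bool (b k))"
      by (rule prod.mono_neutral_cong_right) (auto simp: f_def)
    then show ?thesis using assms(1) by simp
  qed
  moreover have "(\<Prod>k\<in>UNIV. measure_pmf.expectation (bernoulli_pmf (s $ k)) (f k)) = s $ i * s $ j"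
  proof -
    have "(\<Prod>k\<in>UNIV. measure_pmf.expectation (bernoulli_pmf (s $ k)) (f k)) = (\<Prod>k\<in>{i, j}. s $ k)"
      using assms(2) by (intro prod.mono_neutral_cong_right) (auto simp: f_def)
    then show ?thesis using assms(1) by simp
  qed
  moreover have "measure_pmf.expectation (Pi_pmf UNIV False (\<lambda>i. bernoulli_pmf (s $ i))) (\<lambda>b. \<Prod>k\<in>UNIV. f k (b k))
     = (\<Prod>k\<in>UNIV. measure_pmf.expectation (bernoulli_pmf (s $ k)) (f k))"
    by (rule expectation_prod_Pi_pmf) (auto simp: f_def intro: integrable_measure_pmf_finite)
  ultimately show ?thesis by (simp add: bernoulli_design_def)
qed

lemma set_pmf_bernoulli_design:
  assumes "d \<in> set_pmf (bernoulli_design s)"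
  shows "d $ i \<in> {0, 1}" and "s $ i \<in> {0, 1} \<Longrightarrow> d $ i = s $ i"
proof -
  from assms obtain b where b: "d = (\<chi> i. of_bool (b i))" "b i \<in> set_pmf (bernoulli_pmf (s $ i))"
    by (auto simp: bernoulli_design_def set_Pi_pmf PiE_dflt_def)
  then show "d $ i \<in> {0, 1}" by simp
  show "d $ i = s $ i" if "s $ i \<in> {0, 1}"
    using that b by (cases "b i") (auto simp: set_pmf_iff)
qed

text \<open>This makes independent rounding a competitor in the linear program of the landing
  phase.\<close>

lemma bernoulli_design_in_landing_designs:
  assumes "s \<in> cbox 0 1"
  shows "bernoulli_design s \<in> landing_designs s"
  using assms expectation_bernoulli_design[where g = "\<lambda>x. x" and s = s] set_pmf_bernoulli_design[of _ s]
  by (fastforce simp: landing_designs_def fixed_units_def mem_box_cart)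

lemma quadratic_form_sum:
  fixes M :: "real^'q::finite^'q"
  shows "(\<Sum>i\<in>A. a i *\<^sub>R z i) \<bullet> (M *v (\<Sum>i\<in>A. a i *\<^sub>R z i))
    = (\<Sum>i\<in>A. \<Sum>j\<in>A. a i * a j * (z i \<bullet> (M *v z j)))"
  by (subst inner_sum_left)
     (simp add: linear_sum[OF matrix_vector_mul_linear] inner_sum_right sum_distrib_left
        matrix_vector_mult_scaleR mult_ac)

text \<open>Independence removes the cross terms of the quadratic form; the diagonal carries the
  Bernoulli variances.\<close>

lemma landing_cost_bernoulli_design:
  fixes s :: "real^'n::finite" and z :: "real^'q::finite^'n"
  assumes "s \<in> cbox 0 1"
  shows "landing_cost M z s (bernoulli_design s)
    = (\<Sum>i\<in>- fixed_units s. s $ i * (1 - s $ i) * (z $ i \<bullet> (M *v z $ i)))"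
proof -
  let ?U = "- fixed_units s"
  let ?E = "measure_pmf.expectation (bernoulli_design s)"
  have s: "0 \<le> s $ k \<and> s $ k \<le> 1" for k using assms by (auto simp: mem_box_cart)
  have [simp]: "integrable (measure_pmf (bernoulli_design s)) g" for g :: "_ \<Rightarrow> real"
    by (rule integrable_measure_pmf_finite, rule finite_subset[OF _ finite_binary_vectors])
       (use set_pmf_bernoulli_design in blast)
  have cov: "?E (\<lambda>d. (d $ i - s $ i) * (d $ j - s $ j)) = (if i = j then s $ i * (1 - s $ i) else 0)" for i j
  proof (cases "i = j")
    case True
    then show ?thesis
      using expectation_bernoulli_design[of s j "\<lambda>x. (x - s $ j) * (x - s $ j)"] s[of j]
      by (simp add: algebra_simps power2_eq_square)
  next
    case False
    then show ?thesis
      using expectation_bernoulli_design_mult[OF False s] expectation_bernoulli_design[of s _ "\<lambda>x. x"] s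
      by (simp add: algebra_simps)
  qed
  have "landing_cost M z s (bernoulli_design s)
    = ?E (\<lambda>d. \<Sum>i\<in>?U. \<Sum>j\<in>?U. (d $ i - s $ i) * (d $ j - s $ j) * (z $ i \<bullet> (M *v z $ j)))"
    unfolding landing_cost_def Let_def
    by (simp add: quadratic_form_sum)
  also have "\<dots> = (\<Sum>i\<in>?U. \<Sum>j\<in>?U. ?E (\<lambda>d. (d $ i - s $ i) * (d $ j - s $ j)) * (z $ i \<bullet> (M *v z $ j)))"
    by simp
  also have "\<dots> = (\<Sum>i\<in>?U. s $ i * (1 - s $ i) * (z $ i \<bullet> (M *v z $ i)))"
    by (simp add: cov if_distrib[of "\<lambda>x. x * _"] cong: if_cong)
  finally show ?thesis .
qed

subsection \<open>Flight phase\<close>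

lemma mem_balancing_polytope:
  "x \<in> balancing_polytope \<pi> z \<longleftrightarrow> x \<in> cbox 0 1 \<and> x - \<pi> \<in> balancing_kernel \<pi> z"
  by (force simp: balancing_polytope_def image_iff)

lemma subspace_balancing_kernel: "subspace (balancing_kernel \<pi> z)"
  unfolding balancing_kernel_def
  by (simp add: linear_subspace_kernel)

text \<open>Coordinates strictly between 0 and 1 have room on both sides, and \<open>u\<close> does
  not move the others; the balancing equations hold along the whole line.\<close>

lemma balancing_polytope_perturb:
  fixes s :: "real^'n::finite"
  assumes "s \<in> balancing_polytope \<pi> z" "u \<in> balancing_kernel \<pi> z"
    and "\<And>i. i \<in> fixed_units s \<Longrightarrow> u $ i = 0"
  obtains e where "e > 0" "s + e *\<^sub>R u \<in> balancing_polytope \<pi> z" "s - e *\<^sub>R u \<in> balancing_polytope \<pi> z"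
proof -
  \<comment> \<open>The distance of \<open>s $ i\<close> to the boundary of the unit interval. At
    fixed units, where it would be 0, the dummy value 1 keeps the minimum \<open>m\<close>
    positive.\<close>
  define r where "r i = (if i \<in> fixed_units s then 1 else min (s $ i) (1 - s $ i))" for i
  define m where "m = Min (range r)"
  have s: "0 \<le> s $ i" "s $ i \<le> 1" for i
    using assms(1) by (auto simp: mem_balancing_polytope mem_box_cart)
  have "r i > 0" for i
    using s[of i] by (auto simp: r_def fixed_units_def less_le)
  then have m: "m > 0" "m \<le> r i" for i
    by (auto simp: m_def)
  \<comment> \<open>The summand 1 avoids a division by zero when \<open>u = 0\<close>.\<close>
  define e where "e = m / (1 + norm u)"
  have e: "e > 0" using m(1) by (simp add: e_def add_pos_nonneg)
  have b: "\<bar>e * u $ i\<bar> \<le> m" for i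
  proof -
    have "\<bar>u $ i\<bar> \<le> 1 + norm u" using component_le_norm_cart[of u i] by linarith
    then have "m * \<bar>u $ i\<bar> \<le> m * (1 + norm u)" using m(1) by (intro mult_left_mono) auto
    moreover have "1 + norm u > 0" by (simp add: add_pos_nonneg)
    ultimately show ?thesis using m(1) by (simp add: e_def abs_mult field_simps)
  qed
  have "0 \<le> s $ i + e * u $ i \<and> s $ i + e * u $ i \<le> 1 \<and> 0 \<le> s $ i - e * u $ i \<and> s $ i - e * u $ i \<le> 1" for i
    using s[of i] b[of i] m(2)[of i] assms(3)[of i] by (cases "i \<in> fixed_units s") (auto simp: r_def)
  then have box: "s + e *\<^sub>R u \<in> cbox 0 1" "s - e *\<^sub>R u \<in> cbox 0 1"
    by (auto simp: mem_box_cart)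
  have "s - \<pi> \<in> balancing_kernel \<pi> z" "e *\<^sub>R u \<in> balancing_kernel \<pi> z"
    using assms(1,2) by (auto simp: mem_balancing_polytope subspace_balancing_kernel subspace_scale)
  then have "(s - \<pi>) + e *\<^sub>R u \<in> balancing_kernel \<pi> z" "(s - \<pi>) - e *\<^sub>R u \<in> balancing_kernel \<pi> z"
    by (auto intro: subspace_add subspace_diff subspace_balancing_kernel)
  then show thesis
    using e box by (intro that[of e]) (auto simp: mem_balancing_polytope algebra_simps)
qed

lemma card_unfixed_extreme_point:
  fixes s :: "real^'n::finite" and z :: "real^'q::finite^'n"
  assumes "s extreme_point_of balancing_polytope \<pi> z"
  shows "card (- fixed_units s) \<le> CARD('q)"
proof (rule ccontr)
  assume less: "\<not> ?thesis"
  let ?A = "balancing_matrix \<pi> z"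
  let ?V = "{u :: real^'n. \<forall>i. i \<notin> - fixed_units s \<longrightarrow> u $ i = 0}"
  have V: "subspace ?V"
    by (auto simp: subspace_def)
  \<comment> \<open>Dimension count: an injective linear map would carry a space of dimension
    greater than \<open>CARD('q)\<close> into one of dimension \<open>CARD('q)\<close>.\<close>
  have "\<not> inj_on ((*v) ?A) (span ?V)"
  proof
    assume "inj_on ((*v) ?A) (span ?V)"
    then have "dim ((*v) ?A ` ?V) = card (- fixed_units s)"
      using dim_image_eq[of "(*v) ?A" ?V] dim_substandard_cart[where 'a=real, of "- fixed_units s"]
      by (simp add: dim_vec_eq)
    then show False
      using less dim_subset_UNIV[of "(*v) ?A ` ?V"] by simp
  qed
  then obtain u where u: "u \<in> ?V" "?A *v u = 0" "u \<noteq> 0"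
    using V linear_injective_on_subspace_0[OF _ V, of "(*v) ?A"] by (auto simp: span_eq_iff[THEN iffD2])
  have s: "s \<in> balancing_polytope \<pi> z"
    using assms by (simp add: extreme_point_of_def)
  from u s obtain e where e: "e > 0" "s + e *\<^sub>R u \<in> balancing_polytope \<pi> z" "s - e *\<^sub>R u \<in> balancing_polytope \<pi> z"
    by (elim balancing_polytope_perturb[of s \<pi> z u]) (auto simp: balancing_kernel_def)
  have "s = midpoint (s - e *\<^sub>R u) (s + e *\<^sub>R u)"
    by (simp add: midpoint_def algebra_simps scaleR_2[symmetric])
  then have "s \<in> open_segment (s - e *\<^sub>R u) (s + e *\<^sub>R u)"
    using e(1) u(3) midpoint_in_open_segment[of "s - e *\<^sub>R u" "s + e *\<^sub>R u"]
    by (auto simp: algebra_simps scaleR_2[symmetric] )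
  then show False using e assms by (auto simp: extreme_point_of_def)
qed

lemma flight_step_in_polytope:
  assumes "flight_step \<pi> z s s'" "s \<in> balancing_polytope \<pi> z"
  shows "s' \<in> balancing_polytope \<pi> z"
  using assms by (auto simp: flight_step_def current_face_def dest!: facet_of_imp_subset split: if_splits)

text \<open>A facet is a proper face, so a move must gain a fixed unit. The number of fixed units
  thus serves as a termination measure for the walk.\<close>

lemma flight_step_fixes_unit:
  fixes s :: "real^'n::finite"
  assumes "flight_step \<pi> z s s'" "s \<in> balancing_polytope \<pi> z"
    and "\<not> s extreme_point_of balancing_polytope \<pi> z"
  shows "fixed_units s \<subset> fixed_units s'"
proof -
  from assms obtain G where G: "G facet_of current_face \<pi> z s" "s' \<in> G"
    by (auto simp: flight_step_def)
  then have F: "G face_of current_face \<pi> z s" "G \<noteq> current_face \<pi> z s" "s' \<in> current_face \<pi> z s"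
    by (auto simp: facet_of_def dest: face_of_imp_subset)
  have sub: "fixed_units s \<subseteq> fixed_units s'"
    using F(3) by (auto simp: current_face_def fixed_units_def)
  \<comment> \<open>Otherwise \<open>s'\<close> would be in the relative interior of the current face, hence in none of its facets.\<close>
  have "fixed_units s' \<noteq> fixed_units s"
  proof
    assume eq: "fixed_units s' = fixed_units s"
    have "x \<in> G" if x: "x \<in> current_face \<pi> z s" for x
    proof (cases "x = s'")
      case False
      have K: "s' \<in> balancing_polytope \<pi> z" "x \<in> balancing_polytope \<pi> z"
        using x F(3) by (auto simp: current_face_def)
      have "x - s' \<in> balancing_kernel \<pi> z"
        using subspace_diff[OF subspace_balancing_kernel, of "x - \<pi>" \<pi> z "s' - \<pi>"] K
        by (auto simp: mem_balancing_polytope)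
      moreover have fixed: "(x - s') $ i = 0" if "i \<in> fixed_units s" for i
        using that x F(3) by (auto simp: current_face_def)
      ultimately obtain e where e: "e > 0" "s' - e *\<^sub>R (x - s') \<in> balancing_polytope \<pi> z"
        using K(1) eq by (elim balancing_polytope_perturb[of s' \<pi> z "x - s'"]) auto
      \<comment> \<open>The segment from \<open>x\<close> to \<open>s'\<close> is prolonged slightly
        beyond \<open>s'\<close>. Then \<open>s'\<close> is interior to the segment from
        \<open>x\<close> to \<open>y\<close>, and the face \<open>G\<close>, which contains
        \<open>s'\<close>, must contain \<open>x\<close> too.\<close>
      define y where "y = s' - e *\<^sub>R (x - s')"
      have y: "y \<in> current_face \<pi> z s"
        using e(2) fixed F(3) by (auto simp: y_def current_face_def)
      have "s' \<in> open_segment x y"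
      proof -
        have "y \<noteq> x"
        proof
          assume "y = x"
          then have "(1 + e) *\<^sub>R (x - s') = 0" by (simp add: y_def algebra_simps)
          then show False using e(1) False by auto
        qed
        moreover have "s' = (1 - 1 / (1 + e)) *\<^sub>R x + (1 / (1 + e)) *\<^sub>R y"
        proof -
          have "(1 + e) *\<^sub>R s' = e *\<^sub>R x + y" by (simp add: y_def algebra_simps)
          then have "s' = (1 / (1 + e)) *\<^sub>R (e *\<^sub>R x + y)" using e(1)
            by (metis (no_types, opaque_lifting) add_pos_pos less_numeral_extra(1) scaleR_scaleR nonzero_eq_divide_eq order_less_irrefl scaleR_one)
          moreover have "1 - 1 / (1 + e) = e / (1 + e)" using e(1) by (simp add: field_simps)
          ultimately show ?thesis by (simp add: scaleR_add_right)
        qed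
        ultimately show ?thesis
          using e(1) unfolding in_segment by (auto intro!: exI[of _ "1 / (1 + e)"])
      qed
      then show ?thesis
        using F(1) G(2) x y unfolding face_of_def by blast
    qed (use G in simp)
    then show False using F by (auto dest: face_of_imp_subset)
  qed
  with sub show ?thesis by auto
qed

text \<open>As long as no vertex is reached, at least \<open>t\<close> units are fixed after
  \<open>t\<close> moves, which is impossible once \<open>t\<close> exceeds the number of units.
  Hence \<open>LEAST\<close> ranges over a nonempty set.\<close>

lemma flight_ends_at_extreme_point:
  fixes w :: "nat \<Rightarrow> real^'n::finite"
  assumes "w 0 \<in> balancing_polytope \<pi> z"
    and step: "\<And>t. flight_step \<pi> z (w t) (w (Suc t))"
  shows "w (LEAST t. w t extreme_point_of balancing_polytope \<pi> z) extreme_point_of balancing_polytope \<pi> z"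
proof -
  have K: "w t \<in> balancing_polytope \<pi> z" for t
    by (induction t) (use assms flight_step_in_polytope in blast)+
  have "\<exists>t. w t extreme_point_of balancing_polytope \<pi> z"
  proof (rule ccontr)
    assume "\<not> ?thesis"
    then have less: "card (fixed_units (w t)) < card (fixed_units (w (Suc t)))" for t
      using flight_step_fixes_unit[OF step K] by (intro psubset_card_mono) auto
    have "t \<le> card (fixed_units (w t))" for t
      by (induction t) (use less in \<open>auto simp: Suc_le_eq intro: le_less_trans\<close>)
    moreover have "card (fixed_units (w t)) \<le> CARD('n)" for t
      by (intro card_mono) auto
    ultimately show False by (meson not_less_eq_eq order_trans le_refl)
  qed
  then show ?thesis by (rule LeastI_ex)
qed

subsection \<open>Landing phase\<close>

lemma landing_cost_bernoulli_design_le: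
  fixes s :: "real^'n::finite" and z :: "real^'q::finite^'n"
  assumes M: "sym_pos_def M" and s: "s \<in> cbox 0 1"
    and card: "card (- fixed_units s) \<le> k" and B: "\<And>i. z $ i \<bullet> z $ i \<le> B"
  shows "landing_cost M z s (bernoulli_design s) \<le> real k * B / 4 * Max (eigenvalues M)"
proof -
  let ?L = "Max (eigenvalues M)"
  have sym: "transpose M = M" and nn: "0 \<le> x \<bullet> (M *v x)" for x
    using M by (auto simp: sym_pos_def_def) (metis inner_zero_left less_eq_real_def)
  \<comment> \<open>Testing the Rayleigh bound on a unit vector gives the sign of \<open>?L\<close>,
    needed to multiply inequalities. Here \<open>undefined\<close> is just some index.\<close>
  have "0 \<le> ?L * (axis undefined 1 \<bullet> (axis undefined 1 :: real^'q))"
    using nn rayleigh_le_Max_eigenvalues[OF sym] by (rule order_trans)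
  then have L: "0 \<le> ?L" by (simp add: inner_axis_axis)
  have B0: "0 \<le> B" using B[of undefined] inner_ge_zero by (rule order_trans[rotated])
  have "s $ i * (1 - s $ i) * (z $ i \<bullet> (M *v z $ i)) \<le> 1 / 4 * (?L * B)" for i
  proof (rule mult_mono)
    have "0 \<le> (s $ i - 1 / 2)\<^sup>2" by simp
    then show "s $ i * (1 - s $ i) \<le> 1 / 4" by (simp add: power2_eq_square algebra_simps)
    show "z $ i \<bullet> (M *v z $ i) \<le> ?L * B"
      using rayleigh_le_Max_eigenvalues[OF sym, of "z $ i"] mult_left_mono[OF B L, of i] by (rule order_trans)
  qed (use nn s in auto)
  then have "landing_cost M z s (bernoulli_design s) \<le> real (card (- fixed_units s)) * (1 / 4 * (?L * B))"
    unfolding landing_cost_bernoulli_design[OF s] by (rule sum_bounded_above)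
  also have "\<dots> \<le> real k * (1 / 4 * (?L * B))"
    using card L B0 by (intro mult_right_mono) auto
  finally show ?thesis by (simp add: mult_ac)
qed

text \<open>The left-hand side is an expectation under \<open>\<mu>\<close>, written as a finite sum
  so that conditional probabilities can later take the place of \<open>pmf \<mu> d\<close>.\<close>

lemma landing_squared_error_le:
  fixes s :: "real^'n::finite" and z :: "real^'q::finite^'n"
  assumes M: "sym_pos_def M" and s: "s \<in> cbox 0 1"
    and card: "card (- fixed_units s) \<le> k" and B: "\<And>i. z $ i \<bullet> z $ i \<le> B"
    and opt: "is_arg_min (landing_cost M z s) (\<lambda>\<nu>. \<nu> \<in> landing_designs s) \<mu>"
  shows "(\<Sum>d | \<forall>i. d $ i \<in> {0, 1}. (norm (\<Sum>i\<in>UNIV. (d $ i - s $ i) *\<^sub>R z $ i))\<^sup>2 * pmf \<mu> d)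
    \<le> real k * B / 4 * (Max (eigenvalues M) / Min (eigenvalues M))"
    (is "?S \<le> _")
proof -
  let ?l = "Min (eigenvalues M)"
  have sym: "transpose M = M" using M by (simp add: sym_pos_def_def)
  have \<mu>: "\<mu> \<in> landing_designs s" using opt by (simp add: is_arg_min_def)
  then have sub: "set_pmf \<mu> \<subseteq> {d. \<forall>i. d $ i \<in> {0, 1}}"
    by (auto simp: landing_designs_def)
  then have int: "integrable (measure_pmf \<mu>) g" for g :: "_ \<Rightarrow> real"
    by (intro integrable_measure_pmf_finite finite_subset[OF _ finite_binary_vectors])
  have "?l * ?S = ?l * measure_pmf.expectation \<mu> (\<lambda>d. (norm (\<Sum>i\<in>UNIV. (d $ i - s $ i) *\<^sub>R z $ i))\<^sup>2)"
    using sub by (subst integral_measure_pmf[OF finite_binary_vectors]) (auto simp: mult.commute)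
  also have "\<dots> = measure_pmf.expectation \<mu> (\<lambda>d. ?l * (norm (\<Sum>i\<in>UNIV. (d $ i - s $ i) *\<^sub>R z $ i))\<^sup>2)"
    by simp
  also have "\<dots> \<le> landing_cost M z s \<mu>"
    unfolding landing_cost_def
  proof (rule integral_mono_AE[OF int int], rule AE_pmfI)
    fix d assume "d \<in> set_pmf \<mu>"
    \<comment> \<open>Fixed units contribute nothing, since \<open>d\<close> agrees with
      \<open>s\<close> there.\<close>
    then have "(\<Sum>i\<in>UNIV. (d $ i - s $ i) *\<^sub>R z $ i) = (\<Sum>i\<in>- fixed_units s. (d $ i - s $ i) *\<^sub>R z $ i)"
      using \<mu> by (intro sum.mono_neutral_right) (auto simp: landing_designs_def)
    then show "?l * (norm (\<Sum>i\<in>UNIV. (d $ i - s $ i) *\<^sub>R z $ i))\<^sup>2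
      \<le> (let v = \<Sum>i\<in>- fixed_units s. (d $ i - s $ i) *\<^sub>R z $ i in v \<bullet> (M *v v))"
      using rayleigh_ge_Min_eigenvalues[OF sym] by (simp add: Let_def power2_norm_eq_inner)
  qed
  also have "\<dots> \<le> landing_cost M z s (bernoulli_design s)"
    using opt bernoulli_design_in_landing_designs[OF s] by (force simp: is_arg_min_linorder)
  also have "\<dots> \<le> real k * B / 4 * Max (eigenvalues M)"
    by (rule landing_cost_bernoulli_design_le[OF M s card B])
  finally show ?thesis
    using Min_eigenvalues_pos[OF M] by (simp add: field_simps)
qed

text \<open>The squared error is split over the finitely many values \<open>d\<close> of
  \<open>D\<close>. With \<open>d\<close> frozen, \<open>g d\<close> depends only on
  \<open>\<pi>'\<close> and \<open>Z\<close>, so it is measurable for \<open>F\<close>, and the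
  indicator of \<open>D = d\<close> may be replaced by its conditional expectation. The bound for a
  given outcome of the flight phase is then integrated.\<close>

lemma landing_phase_expected_squared_error:
  fixes Z :: "'w \<Rightarrow> real^'q::finite^'n::finite" and \<pi>' D :: "'w \<Rightarrow> real^'n"
  assumes P: "prob_space P" and M: "sym_pos_def M"
    and meas [measurable]: "Z \<in> borel_measurable P" "\<pi>' \<in> borel_measurable P" "D \<in> borel_measurable P"
    and D: "\<forall>\<omega>\<in>space P. \<forall>i. D \<omega> $ i \<in> {0, 1}"
    and box: "AE \<omega> in P. \<pi>' \<omega> \<in> cbox 0 1"
    and card: "AE \<omega> in P. card (- fixed_units (\<pi>' \<omega>)) \<le> k"
    and B: "AE \<omega> in P. \<forall>i. Z \<omega> $ i \<bullet> Z \<omega> $ i \<le> B"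
    and landing: "landing_phase P M Z \<pi>' D"
  shows "integrable P (\<lambda>\<omega>. (norm (\<Sum>i\<in>UNIV. (D \<omega> $ i - \<pi>' \<omega> $ i) *\<^sub>R Z \<omega> $ i))\<^sup>2)" (is "integrable P ?V")
    and "(\<integral>\<omega>. (norm (\<Sum>i\<in>UNIV. (D \<omega> $ i - \<pi>' \<omega> $ i) *\<^sub>R Z \<omega> $ i))\<^sup>2 \<partial>P)
      \<le> real k * B / 4 * (Max (eigenvalues M) / Min (eigenvalues M))" (is "_ \<le> ?bound")
proof -
  interpret prob_space P by fact
  define F where "F = vimage_algebra (space P) (\<lambda>\<omega>. (\<pi>' \<omega>, Z \<omega>)) borel"
  define T where "T = {d :: real^'n. \<forall>i. d $ i \<in> {0, 1}}"
  define g where "g d \<omega> = (norm (\<Sum>i\<in>UNIV. (d $ i - \<pi>' \<omega> $ i) *\<^sub>R Z \<omega> $ i))\<^sup>2" for d \<omega>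
  obtain \<mu> where \<mu>: "\<And>d. AE \<omega> in P. real_cond_exp P F (indicat_real (D -` {d})) \<omega> = pmf (\<mu> \<omega>) d"
    "AE \<omega> in P. is_arg_min (landing_cost M (Z \<omega>) (\<pi>' \<omega>)) (\<lambda>\<nu>. \<nu> \<in> landing_designs (\<pi>' \<omega>)) (\<mu> \<omega>)"
    using landing unfolding landing_phase_def F_def by blast
  have "(\<lambda>\<omega>. (\<pi>' \<omega>, Z \<omega>)) \<in> borel_measurable P"
    by measurable
  then have "subalgebra P F"
    unfolding F_def subalgebra_def by (auto simp: sets_vimage_algebra2 dest: measurable_sets)
  then interpret finite_measure_subalgebra P F by unfold_locales
  interpret sigma_finite_subalgebra P F
    by (rule finite_measure_subalgebra_is_sigma_finite) unfold_locales
  have T: "finite T" unfolding T_def by (rule finite_binary_vectors)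
  have gF: "g d \<in> borel_measurable F" for d
  proof -
    define G where "G = (\<lambda>(s, z :: real^'q^'n). (norm (\<Sum>i\<in>UNIV. (d $ i - s $ i) *\<^sub>R z $ i))\<^sup>2)"
    have "(\<lambda>\<omega>. (\<pi>' \<omega>, Z \<omega>)) \<in> measurable F borel"
      unfolding F_def by (rule measurable_vimage_algebra1) simp
    moreover have "G \<in> borel_measurable borel"
      unfolding G_def case_prod_beta by (intro borel_measurable_continuous_onI continuous_intros)
    ultimately have "(\<lambda>\<omega>. G (\<pi>' \<omega>, Z \<omega>)) \<in> borel_measurable F"
      by (rule measurable_compose)
    moreover have "g d = (\<lambda>\<omega>. G (\<pi>' \<omega>, Z \<omega>))"
      by (simp add: fun_eq_iff g_def G_def)
    ultimately show ?thesis by simp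
  qed
  have gP [measurable]: "g d \<in> borel_measurable P" for d
    by (rule measurable_from_subalg[OF subalg gF])
  have ind [measurable]: "indicat_real (D -` {d}) \<in> borel_measurable P" for d
  proof -
    have "(\<lambda>\<omega>. indicat_real {d} (D \<omega>)) \<in> borel_measurable P" by measurable
    then show ?thesis by (simp add: indicator_def vimage_def)
  qed
  \<comment> \<open>A crude bound by the triangle inequality, which serves only for
    integrability.\<close>
  have bound: "AE \<omega> in P. g d \<omega> \<le> (real CARD('n) * sqrt B)\<^sup>2" if "d \<in> T" for d
    using box B
  proof eventually_elim
    case (elim \<omega>)
    have "norm ((d $ i - \<pi>' \<omega> $ i) *\<^sub>R Z \<omega> $ i) \<le> 1 * sqrt B" for i
      unfolding norm_scaleR
    proof (rule mult_mono)
      have "d $ i = 0 \<or> d $ i = 1" using that by (auto simp: T_def)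
      moreover have "0 \<le> \<pi>' \<omega> $ i" "\<pi>' \<omega> $ i \<le> 1"
        using elim(1) by (auto simp: mem_box_cart)
      ultimately show "\<bar>d $ i - \<pi>' \<omega> $ i\<bar> \<le> 1" by auto
    qed (use elim(2) in \<open>auto simp: norm_eq_sqrt_inner\<close>)
    then have "norm (\<Sum>i\<in>UNIV. (d $ i - \<pi>' \<omega> $ i) *\<^sub>R Z \<omega> $ i) \<le> real CARD('n) * sqrt B"
      by (intro sum_norm_bound) auto
    then show ?case unfolding g_def by (intro power_mono) auto
  qed
  have int: "integrable P (\<lambda>\<omega>. g d \<omega> * indicat_real (D -` {d}) \<omega>)" if "d \<in> T" for d
  proof (rule integrable_const_bound)
    show "AE \<omega> in P. norm (g d \<omega> * indicat_real (D -` {d}) \<omega>) \<le> (real CARD('n) * sqrt B)\<^sup>2"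
      using bound[OF that] by eventually_elim (auto simp: indicator_def g_def)
  qed measurable
  note cond = real_cond_exp_intg[OF int gF ind]
  have V: "?V \<omega> = (\<Sum>d\<in>T. g d \<omega> * indicat_real (D -` {d}) \<omega>)" if "\<omega> \<in> space P" for \<omega>
  proof -
    have "D \<omega> \<in> T" using D that by (auto simp: T_def)
    moreover have "g d \<omega> * indicat_real (D -` {d}) \<omega> = (if D \<omega> = d then g d \<omega> else 0)" for d
      by simp
    ultimately show ?thesis using T by (simp add: g_def)
  qed
  show "integrable P ?V"
    using int by (simp add: V cong: Bochner_Integration.integrable_cong)
  have "(\<integral>\<omega>. ?V \<omega> \<partial>P) = (\<integral>\<omega>. (\<Sum>d\<in>T. g d \<omega> * indicat_real (D -` {d}) \<omega>) \<partial>P)"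
    by (rule Bochner_Integration.integral_cong[OF refl V])
  also have "\<dots> = (\<Sum>d\<in>T. \<integral>\<omega>. g d \<omega> * real_cond_exp P F (indicat_real (D -` {d})) \<omega> \<partial>P)"
    using int by (simp add: Bochner_Integration.integral_sum cond(2))
  also have "\<dots> = (\<integral>\<omega>. (\<Sum>d\<in>T. g d \<omega> * real_cond_exp P F (indicat_real (D -` {d})) \<omega>) \<partial>P)"
    using cond(1) by (simp add: Bochner_Integration.integral_sum)
  also have "\<dots> \<le> (\<integral>\<omega>. ?bound \<partial>P)"
  proof (rule integral_mono_AE)
    \<comment> \<open>The null set may depend on \<open>d\<close>; as \<open>T\<close> is finite,
      the union of these sets is still null.\<close>
    have "AE \<omega> in P. \<forall>d\<in>T. real_cond_exp P F (indicat_real (D -` {d})) \<omega> = pmf (\<mu> \<omega>) d"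
      using T \<mu>(1) by (simp add: AE_finite_all)
    then show "AE \<omega> in P. (\<Sum>d\<in>T. g d \<omega> * real_cond_exp P F (indicat_real (D -` {d})) \<omega>) \<le> ?bound"
      using \<mu>(2) box card B
    proof eventually_elim
      case (elim \<omega>)
      then show ?case
        using landing_squared_error_le[OF M elim(3,4) _ elim(2), of B] by (simp add: g_def T_def)
    qed
  qed (use cond(1) in auto)
  finally show "(\<integral>\<omega>. ?V \<omega> \<partial>P) \<le> ?bound" by (simp add: prob_space)
qed


text \<open>The conditions at the countably many times hold jointly off one null set, so the
  deterministic result applies path by path.\<close>

lemma flight_phase_ends_at_extreme_point:
  fixes Z :: "'w \<Rightarrow> real^'q::finite^'n::finite"
  assumes \<pi>: "\<And>i. 0 \<le> \<pi> $ i \<and> \<pi> $ i \<le> 1"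
    and flight: "flight_phase P \<pi> Z w \<pi>'"
  shows "AE \<omega> in P. \<pi>' \<omega> extreme_point_of balancing_polytope \<pi> (Z \<omega>)"
proof -
  have "AE \<omega> in P. w 0 \<omega> = \<pi>" "AE \<omega> in P. \<forall>t. flight_step \<pi> (Z \<omega>) (w t \<omega>) (w (Suc t) \<omega>)"
    "AE \<omega> in P. \<pi>' \<omega> = w (LEAST t. w t \<omega> extreme_point_of balancing_polytope \<pi> (Z \<omega>)) \<omega>"
    using flight by (auto simp: flight_phase_def AE_all_countable)
  then show ?thesis
  proof eventually_elim
    case (elim \<omega>)
    have "\<pi> \<in> balancing_polytope \<pi> (Z \<omega>)"
      using \<pi> by (auto simp: mem_balancing_polytope mem_box_cart balancing_kernel_def)
    then show ?case
      using flight_ends_at_extreme_point[of "\<lambda>t. w t \<omega>" \<pi> "Z \<omega>"] elim by simp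
  qed
qed

lemma balancing_kernel_iff:
  "u \<in> balancing_kernel \<pi> z \<longleftrightarrow> (\<Sum>i\<in>UNIV. (u $ i / \<pi> $ i) *\<^sub>R z $ i) = 0"
  by (simp add: balancing_kernel_def balancing_matrix_def matrix_vector_mult_def vec_eq_iff mult.commute)

subsection \<open>Imbalance\<close>

lemma inner_with_intercept: "with_intercept x \<bullet> with_intercept y = 1 + x \<bullet> y"
  by (simp add: with_intercept_def inner_vec_def UNIV_option_conv sum.reindex)

text \<open>The intercept adds the square of the sum of the coefficients to the squared
  norm.\<close>

lemma norm_sum_with_intercept_ge:
  "norm (\<Sum>i\<in>A. a i *\<^sub>R x i) \<le> norm (\<Sum>i\<in>A. a i *\<^sub>R with_intercept (x i))"
proof -
  have "(\<Sum>i\<in>A. a i *\<^sub>R with_intercept (x i)) \<bullet> (\<Sum>i\<in>A. a i *\<^sub>R with_intercept (x i))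
    = (\<Sum>i\<in>A. a i)\<^sup>2 + (\<Sum>i\<in>A. a i *\<^sub>R x i) \<bullet> (\<Sum>i\<in>A. a i *\<^sub>R x i)"
    by (simp add: inner_sum_left inner_sum_right inner_with_intercept power2_eq_square sum_distrib_left
        sum_distrib_right sum.distrib algebra_simps)
  then show ?thesis by (simp add: norm_le)
qed

text \<open>The balancing equations allow \<open>s\<close> to be replaced by 1/2 in the weighted
  sum. The factor 4 is the 2 in \<open>imbalance\<close> times the 2 from
  \<open>d - (1 - d) = 2 * (d - 1/2)\<close>.\<close>

lemma norm_imbalance_le:
  fixes x :: "'n::finite \<Rightarrow> real^'p::finite" and d :: "real^'n"
  assumes "s - (\<chi> i. 1 / 2) \<in> balancing_kernel (\<chi> i. 1 / 2) (\<chi> i. with_intercept (x i))"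
  shows "norm (imbalance x d)
    \<le> 4 / real CARD('n) * norm (\<Sum>i\<in>UNIV. (d $ i - s $ i) *\<^sub>R with_intercept (x i))"
proof -
  \<comment> \<open>The factor 2 is the inverse of the assignment probability in the balancing
    matrix.\<close>
  have "0 = (\<Sum>i\<in>UNIV. 2 *\<^sub>R ((s $ i - 1 / 2) *\<^sub>R with_intercept (x i)))"
    using assms by (simp add: balancing_kernel_iff mult.commute)
  then have "(\<Sum>i\<in>UNIV. (s $ i - 1 / 2) *\<^sub>R with_intercept (x i)) = 0"
    unfolding scaleR_sum_right[symmetric] by simp
  then have "(\<Sum>i\<in>UNIV. (d $ i - s $ i) *\<^sub>R with_intercept (x i))
    = (\<Sum>i\<in>UNIV. (d $ i - s $ i) *\<^sub>R with_intercept (x i)) + (\<Sum>i\<in>UNIV. (s $ i - 1 / 2) *\<^sub>R with_intercept (x i))"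
    by simp
  also have "\<dots> = (\<Sum>i\<in>UNIV. (d $ i - 1 / 2) *\<^sub>R with_intercept (x i))"
    by (simp flip: sum.distrib scaleR_add_left)
  finally have "norm (\<Sum>i\<in>UNIV. (d $ i - 1 / 2) *\<^sub>R x i)
    \<le> norm (\<Sum>i\<in>UNIV. (d $ i - s $ i) *\<^sub>R with_intercept (x i))"
    by (simp add: norm_sum_with_intercept_ge)
  moreover have "imbalance x d = (4 / real CARD('n)) *\<^sub>R (\<Sum>i\<in>UNIV. (d $ i - 1 / 2) *\<^sub>R x i)"
  proof -
    have "d $ i *\<^sub>R x i - (1 - d $ i) *\<^sub>R x i = 2 *\<^sub>R ((d $ i - 1 / 2) *\<^sub>R x i)" for i
      by (simp add: algebra_simps flip: scaleR_diff_left)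
    then show ?thesis by (simp only: imbalance_def flip: scaleR_sum_right) simp
  qed
  ultimately show ?thesis
    by (simp add: mult_left_mono divide_right_mono)
qed

lemma inner_self_cbox_le:
  fixes x :: "real^'p::finite"
  assumes "x \<in> cbox 0 1"
  shows "x \<bullet> x \<le> real CARD('p)"
proof -
  have "x $ i * x $ i \<le> 1" for i
    using assms by (auto simp: mem_box_cart intro: mult_le_one)
  then have "(\<Sum>i\<in>UNIV. x $ i * x $ i) \<le> (\<Sum>i\<in>(UNIV :: 'p set). 1)"
    by (intro sum_mono)
  then show ?thesis by (simp add: inner_vec_def)
qed

theorem proposition2:
  fixes P :: "'w measure"
    and X :: "'n::finite \<Rightarrow> 'w \<Rightarrow> real^'p::finite"
    and D :: "'w \<Rightarrow> real^'n"
    and f :: "real^'p \<Rightarrow> real"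
    and C_low C_up :: real
    and M :: "real^'p option^'p option"
  assumes "prob_space P"
    and "even CARD('n)"
    and "prob_space.indep_vars P (\<lambda>_. borel) X UNIV"
    and "\<And>i. distributed P lborel (X i) (\<lambda>x. ennreal (f x) * indicator (cbox 0 1) x)"
    and "0 < C_low" and "0 < C_up"
    and "\<And>x. x \<in> cbox 0 1 \<Longrightarrow> C_low \<le> f x \<and> f x \<le> C_up"
    and "sym_pos_def M"
    and "cube_method P M (\<chi> i. 1 / 2) (\<lambda>\<omega>. \<chi> i. with_intercept (X i \<omega>)) D"
  shows "prob_space.expectation P (\<lambda>\<omega>. (norm (imbalance (\<lambda>i. X i \<omega>) (D \<omega>)))\<^sup>2)
    \<le> 4 * ((real CARD('p) + 1)\<^sup>2 / (real CARD('n))\<^sup>2) * (Max (eigenvalues M) / Min (eigenvalues M))"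
proof -
  interpret prob_space P by fact
  define Z where "Z \<omega> = (\<chi> i. with_intercept (X i \<omega>))" for \<omega>
  let ?\<pi> = "(\<chi> i. 1 / 2) :: real^'n"
  obtain w \<pi>' where flight: "flight_phase P ?\<pi> Z w \<pi>'" and landing: "landing_phase P M Z \<pi>' D"
    and [measurable]: "Z \<in> borel_measurable P" "D \<in> borel_measurable P"
    and D: "\<forall>\<omega>\<in>space P. \<forall>i. D \<omega> $ i \<in> {0, 1}"
    using assms(9) unfolding cube_method_def Z_def by blast
  have [measurable]: "\<pi>' \<in> borel_measurable P"
    using flight by (simp add: flight_phase_def)
  have extreme: "AE \<omega> in P. \<pi>' \<omega> extreme_point_of balancing_polytope ?\<pi> (Z \<omega>)"
    by (rule flight_phase_ends_at_extreme_point[OF _ flight]) simp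
  then have polytope: "AE \<omega> in P. \<pi>' \<omega> \<in> balancing_polytope ?\<pi> (Z \<omega>)"
    by eventually_elim (simp add: extreme_point_of_def)
  then have box: "AE \<omega> in P. \<pi>' \<omega> \<in> cbox 0 1"
    by eventually_elim (simp add: mem_balancing_polytope)
  have card: "AE \<omega> in P. card (- fixed_units (\<pi>' \<omega>)) \<le> CARD('p option)"
    using extreme by eventually_elim (rule card_unfixed_extreme_point)
  \<comment> \<open>The density of \<open>X i\<close> vanishes outside the unit cube.\<close>
  have "AE \<omega> in P. X i \<omega> \<in> cbox 0 1" for i
    by (subst distributed_AE2[OF assms(4)])
      (auto simp: indicator_def intro!: AE_I2)
  then have "AE \<omega> in P. \<forall>i. X i \<omega> \<in> cbox 0 1"
    by (simp add: AE_all_countable)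
  then have B: "AE \<omega> in P. \<forall>i. Z \<omega> $ i \<bullet> Z \<omega> $ i \<le> real CARD('p) + 1"
    by eventually_elim (simp add: Z_def inner_with_intercept inner_self_cbox_le add.commute)
  note V = landing_phase_expected_squared_error[OF assms(1,8) \<open>Z \<in> _\<close> \<open>\<pi>' \<in> _\<close> \<open>D \<in> _\<close> D box card B landing]
  let ?V = "\<lambda>\<omega>. (norm (\<Sum>i\<in>UNIV. (D \<omega> $ i - \<pi>' \<omega> $ i) *\<^sub>R Z \<omega> $ i))\<^sup>2"
  have "expectation (\<lambda>\<omega>. (norm (imbalance (\<lambda>i. X i \<omega>) (D \<omega>)))\<^sup>2)
    \<le> expectation (\<lambda>\<omega>. (4 / real CARD('n))\<^sup>2 * ?V \<omega>)"
  \<comment> \<open>This rule asks for integrability of the dominating function only.\<close>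
  proof (rule integral_mono_AE')
    show "AE \<omega> in P. (norm (imbalance (\<lambda>i. X i \<omega>) (D \<omega>)))\<^sup>2 \<le> (4 / real CARD('n))\<^sup>2 * ?V \<omega>"
      using polytope
    proof eventually_elim
      case (elim \<omega>)
      then show ?case
        using power_mono[OF norm_imbalance_le[of "\<pi>' \<omega>" "\<lambda>i. X i \<omega>" "D \<omega>"], of 2]
        by (simp add: mem_balancing_polytope Z_def power_mult_distrib power_divide)
    qed
    show "integrable P (\<lambda>\<omega>. (4 / real CARD('n))\<^sup>2 * ?V \<omega>)"
      using V(1) by simp
  qed auto
  also have "\<dots> = (4 / real CARD('n))\<^sup>2 * expectation ?V" by simp
  \<comment> \<open>One factor \<open>p + 1\<close> counts the units left to the landing phase, the
    other bounds the squared norm of a balancing vector, and 1/4 bounds the Bernoulli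
    variance.\<close>
  also have "\<dots> \<le> (4 / real CARD('n))\<^sup>2 *
      (real CARD('p option) * (real CARD('p) + 1) / 4 * (Max (eigenvalues M) / Min (eigenvalues M)))"
    by (intro mult_left_mono V(2)) simp
  also have "\<dots> = 4 * ((real CARD('p) + 1)\<^sup>2 / (real CARD('n))\<^sup>2) * (Max (eigenvalues M) / Min (eigenvalues M))"
  proof -
    have "(4 / n)\<^sup>2 * (q * q / 4 * r) = 4 * (q\<^sup>2 / n\<^sup>2) * r" for n q r :: real
      by (simp add: power2_eq_square)
    moreover have "real CARD('p option) = real CARD('p) + 1" by simp
    ultimately show ?thesis by (simp only:)
  qed
  finally show ?thesis .
qed

end
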